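(* Let $E$ be a Banach space, $I^\infty=(-\infty,0]$, and let $H\subset\mathrm{Map}(I^\infty,E)$ be a history space. Assume that $\boldsymbol 0$ is closed under $C^1$-prolongations with $0$-derivative in $H$ (so that $C^1_{\mathrm c}(I^\infty,E)\subset H$). Then the following properties are equivalent: (a) $H$ is regulated by $C^1$-prolongations. (b) For each $R>0$, the topology of $H$ (restricted to the set below) is coarser than or equal to the topology of uniform $C^1$-convergence on $$\{\phi\in C^1_{\mathrm c}(I^\infty,E):\mathrm{supp}(\phi)\subset[-R,0]\};$$ that is, the inclusion of this space, equipped with the norm $\|\cdot\|_{C^1}$, into $H$ is continuous.
   Context: $\mathbb{R}_+=[0,\infty)$. $\mathrm{Map}(I,E)$ is the linear space of all maps $I\to E$; $\boldsymbol 0$ is the zero map. A history space is a linear subspace $H\subset\mathrm{Map}(I,E)$ with a topology for which the linear operations are continuous. For an interval $J$, $J+I=\{t+\theta:t\in J,\theta\in I\}$; for $\gamma\colon J+I\to E$ and $t\in J$, $I_t\gamma\in\mathrm{Map}(I,E)$ is $I_t\gamma(\theta)=\gamma(t+\theta)$. Here $I=I^\infty$. $\|f\|_{C^1}=\sup\|f\|_E+\sup\|f'\|_E$, and $\|f\|_{C^1[0,T]}$ is this norm of $f|_{[0,T]}$. $C^1_{\mathrm c}(I^\infty,E)$ is the set of $C^1$ maps $I^\infty\to E$ with compact support. A $C^1$-prolongation of $\boldsymbol 0$ is a map $\gamma\colon J+I\to E$, where $J$ is an interval with left end point $0\in J$ ($J=\{0\}$ allowed, counting as $C^1$), with $\gamma(\theta)=0$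 for $\theta\in I$ and $\gamma|_J$ of class $C^1$ (one-sided derivatives at end points); it is "with $0$-derivative" if the right derivative $\gamma'(0)$ is $0$. "$\boldsymbol 0$ is closed under $C^1$-prolongations with $0$-derivative in $H$" means that $I_t\gamma\in H$ for all $t\ge0$ and every $C^1$-prolongation $\gamma\colon\mathbb{R}_++I\to E$ of $\boldsymbol 0$ with $0$-derivative. For $T>0$ and $0\le\delta\le\infty$, $\varGamma^1_{0,\boldsymbol 0}(T,\delta,0)$ is the set of $C^1$-prolongations $\gamma\colon[0,T]+I\to E$ of $\boldsymbol 0$ with $0$-derivative and $\|\gamma\|_{C^1[0,T]}\le\delta$; $\varGamma^1_{0,\boldsymbol 0}(0,\delta,0)=\{\boldsymbol 0\}$. Put $$\varLambda^1_{0,\boldsymbol 0}(T,\delta,0)=\bigcup_{\tau\in[0,T]}\{(\tau,I_\tau\gamma):\gamma\in\varGamma^1_{0,\boldsymbol 0}(\tau,\delta,0)\}.$$ $H$ is regulated by $C^1$-prolongations if for every $T>0$ and every neighborhood $N$ of $\boldsymbol 0$ in $H$ there is $\delta>0$ with $\varLambda^1_{0,\boldsymbol 0}(T,\delta,0)\subset[0,T]\times N$. *)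

theory Defs
  imports "HOL-Analysis.Analysis" "HOL-Library.Set_Algebras" "HOL-Library.Extended_Nonnegative_Real"
begin

text \<open>
  A map on a set of reals \<open>D\<close> is represented by the function on the whole real line that extends it
  by 0.  This makes the representation unique, and turns the linear operations into the pointwise
  ones and the zero map into \<open>\<lambda>_. 0\<close>.
\<close>

definition Map :: "real set \<Rightarrow> (real \<Rightarrow> 'e::real_vector) set" where
  "Map D = {f. \<forall>x. x \<notin> D \<longrightarrow> f x = 0}"

abbreviation I_inf :: "real set" where
  "I_inf \<equiv> {..0}"

text \<open>The history space is the carrier of the topology; no separation axiom is imposed.\<close>

definition history_space :: "(real \<Rightarrow> 'e::real_vector) topology \<Rightarrow> bool" where
  "history_space H \<longleftrightarrow>
     topspace H \<subseteq> Map I_inf \<and>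
     (\<lambda>_. 0) \<in> topspace H \<and>
     (\<forall>\<phi>\<in>topspace H. \<forall>\<psi>\<in>topspace H. (\<lambda>\<theta>. \<phi> \<theta> + \<psi> \<theta>) \<in> topspace H) \<and>
     (\<forall>c. \<forall>\<phi>\<in>topspace H. (\<lambda>\<theta>. c *\<^sub>R \<phi> \<theta>) \<in> topspace H) \<and>
     continuous_map (prod_topology H H) H (\<lambda>(\<phi>, \<psi>). \<lambda>\<theta>. \<phi> \<theta> + \<psi> \<theta>) \<and>
     continuous_map (prod_topology euclideanreal H) H (\<lambda>(c, \<phi>). \<lambda>\<theta>. c *\<^sub>R \<phi> \<theta>)"

definition segment_at :: "real \<Rightarrow> (real \<Rightarrow> 'e::real_vector) \<Rightarrow> real \<Rightarrow> 'e" where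
  "segment_at t \<gamma> = (\<lambda>\<theta>. if \<theta> \<in> I_inf then \<gamma> (t + \<theta>) else 0)"

text \<open>
  Derivatives are taken within \<open>S\<close>, hence are one-sided at end points, in contrast to
  \<^const>\<open>C1_differentiable_on\<close>.  On a singleton the condition is vacuous.
\<close>

definition C1_on :: "real set \<Rightarrow> (real \<Rightarrow> 'e::real_normed_vector) \<Rightarrow> bool" where
  "C1_on S f \<longleftrightarrow>
     (\<exists>f'. (\<forall>t\<in>S. (f has_vector_derivative f' t) (at t within S)) \<and> continuous_on S f')"

text \<open>
  The norm takes values in \<open>[0, \<infinity>]\<close>, so that no supremum depends on boundedness.  Since derivatives
  within a singleton are not unique, it is used only for intervals of positive length.
\<close>

definition C1_norm :: "real set \<Rightarrow> (real \<Rightarrow> 'e::real_normed_vector) \<Rightarrow> ennreal" where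
  "C1_norm S f =
     (SUP t\<in>S. ennreal (norm (f t))) +
     (SUP t\<in>S. ennreal (norm (vector_derivative f (at t within S))))"

definition C1_prolongation0 :: "real set \<Rightarrow> (real \<Rightarrow> 'e::real_normed_vector) \<Rightarrow> bool" where
  "C1_prolongation0 J \<gamma> \<longleftrightarrow>
     is_interval J \<and> 0 \<in> J \<and> J \<subseteq> {0..} \<and>
     \<gamma> \<in> Map (J + I_inf) \<and> (\<forall>\<theta>\<in>I_inf. \<gamma> \<theta> = 0) \<and> C1_on J \<gamma>"

definition C1_prolongation0_deriv0 :: "real set \<Rightarrow> (real \<Rightarrow> 'e::real_normed_vector) \<Rightarrow> bool" where
  "C1_prolongation0_deriv0 J \<gamma> \<longleftrightarrow>
     C1_prolongation0 J \<gamma> \<and> (\<gamma> has_vector_derivative 0) (at 0 within J)"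

definition zero_closed_under_C1_prolongations ::
    "(real \<Rightarrow> 'e::real_normed_vector) topology \<Rightarrow> bool" where
  "zero_closed_under_C1_prolongations H \<longleftrightarrow>
     (\<forall>\<gamma>. C1_prolongation0_deriv0 {0..} \<gamma> \<longrightarrow> (\<forall>t\<ge>0. segment_at t \<gamma> \<in> topspace H))"

definition Gamma1 :: "real \<Rightarrow> ennreal \<Rightarrow> (real \<Rightarrow> 'e::real_normed_vector) set" where
  "Gamma1 T \<delta> =
     (if T = 0 then {\<lambda>_. 0}
      else {\<gamma>. C1_prolongation0_deriv0 {0..T} \<gamma> \<and> C1_norm {0..T} \<gamma> \<le> \<delta>})"

definition Lambda1 :: "real \<Rightarrow> ennreal \<Rightarrow> (real \<times> (real \<Rightarrow> 'e::real_normed_vector)) set" where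
  "Lambda1 T \<delta> = (\<Union>\<tau>\<in>{0..T}. {(\<tau>, segment_at \<tau> \<gamma>) |\<gamma>. \<gamma> \<in> Gamma1 \<tau> \<delta>})"

definition nbhd_in :: "'a topology \<Rightarrow> 'a \<Rightarrow> 'a set \<Rightarrow> bool" where
  "nbhd_in X x N \<longleftrightarrow> N \<subseteq> topspace X \<and> (\<exists>U. openin X U \<and> x \<in> U \<and> U \<subseteq> N)"

definition regulated_by_C1_prolongations ::
    "(real \<Rightarrow> 'e::real_normed_vector) topology \<Rightarrow> bool" where
  "regulated_by_C1_prolongations H \<longleftrightarrow>
     (\<forall>T>0. \<forall>N. nbhd_in H (\<lambda>_. 0) N \<longrightarrow> (\<exists>\<delta>>0. Lambda1 T \<delta> \<subseteq> {0..T} \<times> N))"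

definition supp :: "(real \<Rightarrow> 'e::real_vector) \<Rightarrow> real set" where
  "supp \<phi> = closure {\<theta>\<in>I_inf. \<phi> \<theta> \<noteq> 0}"

definition C1_c :: "(real \<Rightarrow> 'e::real_normed_vector) set" where
  "C1_c = {\<phi> \<in> Map I_inf. C1_on I_inf \<phi> \<and> compact (supp \<phi>)}"

definition C1_c_within :: "real \<Rightarrow> (real \<Rightarrow> 'e::real_normed_vector) set" where
  "C1_c_within R = {\<phi> \<in> C1_c. supp \<phi> \<subseteq> {-R..0}}"

definition C1_dist :: "(real \<Rightarrow> 'e::real_normed_vector) \<Rightarrow> (real \<Rightarrow> 'e) \<Rightarrow> real" where
  "C1_dist \<phi> \<psi> = enn2real (C1_norm I_inf (\<lambda>\<theta>. \<phi> \<theta> - \<psi> \<theta>))"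

definition uniform_C1_topology :: "real \<Rightarrow> (real \<Rightarrow> 'e::real_normed_vector) topology" where
  "uniform_C1_topology R = Metric_space.mtopology (C1_c_within R) C1_dist"

text \<open>
  \<^const>\<open>Metric_space.mtopology\<close> is meaningful only for a metric; the rest of this theory shows that
  \<^const>\<open>C1_dist\<close> is one.
\<close>

lemma vector_derivative_within_I_inf:
  assumes "(f has_vector_derivative y) (at t within I_inf)" "t \<in> I_inf"
  shows "vector_derivative f (at t within I_inf) = y"
proof -
  have "connected I_inf" by (rule convex_connected) simp
  moreover have "I_inf \<noteq> {a}" for a :: real
    by (metis atMost_iff infinite_Iic finite.emptyI finite_insert)
  ultimately have "t islimpt I_inf" using assms(2) by (intro connected_imp_perfect) auto
  then show ?thesis
    using assms(1) by (intro vector_derivative_within) (auto simp: trivial_limit_within)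
qed

lemma C1_c_within_bounded:
  assumes "\<phi> \<in> C1_c_within R"
  obtains f' where "\<And>t. t \<in> I_inf \<Longrightarrow> (\<phi> has_vector_derivative f' t) (at t within I_inf)"
    and "bounded (\<phi> ` I_inf)" and "bounded (f' ` I_inf)"
proof -
  obtain f' where f': "\<And>t. t \<in> I_inf \<Longrightarrow> (\<phi> has_vector_derivative f' t) (at t within I_inf)"
    and cf': "continuous_on I_inf f'"
    using assms unfolding C1_c_within_def C1_c_def C1_on_def by blast
  have supp: "supp \<phi> \<subseteq> {-R..0}" using assms by (auto simp: C1_c_within_def)
  have cphi: "continuous_on I_inf \<phi>"
    using f' has_vector_derivative_continuous continuous_on_eq_continuous_within by blast
  have z: "\<phi> t = 0" if "t < -R" "t \<in> I_inf" for t
    using that supp closure_subset[of "{\<theta>\<in>I_inf. \<phi> \<theta> \<noteq> 0}"] unfolding supp_def by fastforce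
  have z': "f' t = 0" if t: "t < -R" "t \<in> I_inf" for t
  proof -
    have "(\<phi> has_vector_derivative 0) (at t within I_inf)"
    proof (rule has_vector_derivative_transform_within[where d = "-R - t" and f = "\<lambda>_. 0"])
      show "0 = \<phi> s" if "s \<in> I_inf" "dist s t < -R - t" for s
        using z[of s] that by (simp add: dist_real_def)
    qed (use t in auto)
    then show ?thesis
      using vector_derivative_within_I_inf f' t by metis
  qed
  have bd: "bounded (g ` I_inf)"
    if c: "continuous_on I_inf g" and g: "\<And>t. t < -R \<Longrightarrow> t \<in> I_inf \<Longrightarrow> g t = 0"
    for g :: "real \<Rightarrow> 'a"
  proof (rule bounded_subset)
    have "continuous_on {-R..0} g" using c by (rule continuous_on_subset) auto
    then show "bounded (insert 0 (g ` {-R..0}))"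
      by (simp add: compact_imp_bounded compact_continuous_image)
    show "g ` I_inf \<subseteq> insert 0 (g ` {-R..0})"
    proof
      fix y assume "y \<in> g ` I_inf"
      then obtain t where "t \<in> I_inf" "y = g t" by blast
      then show "y \<in> insert 0 (g ` {-R..0})" using g[of t] by (cases "t < -R") auto
    qed
  qed
  show ?thesis using that f' bd[OF cphi z] bd[OF cf' z'] by blast
qed

lemma vector_derivative_I_inf_minus:
  assumes t: "t \<in> I_inf"
  shows "norm (vector_derivative (\<lambda>\<theta>. - f \<theta>) (at t within I_inf)) =
         norm (vector_derivative f (at t within I_inf))"
proof (cases "\<exists>y. (f has_vector_derivative y) (at t within I_inf)")
  case True
  then obtain y where "(f has_vector_derivative y) (at t within I_inf)" by blast
  then show ?thesis
    using vector_derivative_within_I_inf[OF _ t] has_vector_derivative_minus by (metis norm_minus_cancel)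
next
  case False
  then have "\<not> ((\<lambda>\<theta>. - f \<theta>) has_vector_derivative y) (at t within I_inf)" for y
    using has_vector_derivative_minus by fastforce
  with False show ?thesis by (simp add: vector_derivative_def)
qed

lemma Metric_space_C1_dist: "Metric_space (C1_c_within R) C1_dist"
proof -
  let ?S = "\<lambda>f::real \<Rightarrow> 'a. SUP t\<in>I_inf. ennreal (norm (f t))"
  have "\<forall>\<phi>\<in>C1_c_within R :: (real \<Rightarrow> 'a) set. \<exists>f'.
      (\<forall>t\<in>I_inf. (\<phi> has_vector_derivative f' t) (at t within I_inf)) \<and>
      bounded (\<phi> ` I_inf) \<and> bounded (f' ` I_inf)"
    by (meson C1_c_within_bounded)
  then obtain D where D: "\<And>\<phi>::real \<Rightarrow> 'a. \<phi> \<in> C1_c_within R \<Longrightarrow>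
      (\<forall>t\<in>I_inf. (\<phi> has_vector_derivative D \<phi> t) (at t within I_inf)) \<and>
      bounded (\<phi> ` I_inf) \<and> bounded (D \<phi> ` I_inf)"
    by metis
  have norm_eq: "C1_norm I_inf (\<lambda>\<theta>. \<phi> \<theta> - \<psi> \<theta>) =
      ?S (\<lambda>t. \<phi> t - \<psi> t) + ?S (\<lambda>t. D \<phi> t - D \<psi> t)"
    if m: "\<phi> \<in> C1_c_within R" "\<psi> \<in> C1_c_within R" for \<phi> \<psi>
  proof -
    have "vector_derivative (\<lambda>\<theta>. \<phi> \<theta> - \<psi> \<theta>) (at t within I_inf) = D \<phi> t - D \<psi> t"
      if "t \<in> I_inf" for t
      using D m that
      by (intro vector_derivative_within_I_inf has_vector_derivative_diff) auto
    then show ?thesis unfolding C1_norm_def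
      by (intro arg_cong2[where f = "(+)"] SUP_cong refl) simp
  qed
  have fin: "?S (\<lambda>t. f t - g t) < top" if "bounded (f ` I_inf)" "bounded (g ` I_inf)" for f g
  proof -
    have "bounded ((\<lambda>t. f t - g t) ` I_inf)" using bounded_minus_comp[OF that] .
    then obtain B where "\<forall>x\<in>(\<lambda>t. f t - g t) ` I_inf. norm x \<le> B" by (auto simp: bounded_iff)
    then have "?S (\<lambda>t. f t - g t) \<le> ennreal B" by (intro SUP_least ennreal_leI) auto
    then show ?thesis using ennreal_less_top le_less_trans by blast
  qed
  have finite_norm: "C1_norm I_inf (\<lambda>\<theta>. \<phi> \<theta> - \<psi> \<theta>) < top"
    if "\<phi> \<in> C1_c_within R" "\<psi> \<in> C1_c_within R" for \<phi> \<psi> :: "real \<Rightarrow> 'a"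
    using that D fin by (simp add: norm_eq)
  have tri: "?S (\<lambda>t. f t - h t) \<le> ?S (\<lambda>t. f t - g t) + ?S (\<lambda>t. g t - h t)" for f g h
  proof (rule SUP_least)
    fix t :: real assume t: "t \<in> I_inf"
    have "norm (f t - h t) \<le> norm (f t - g t) + norm (g t - h t)"
      by (metis diff_add_cancel add_diff_eq norm_triangle_ineq)
    then have "ennreal (norm (f t - h t)) \<le> ennreal (norm (f t - g t)) + ennreal (norm (g t - h t))"
      by (simp flip: ennreal_plus)
    also have "\<dots> \<le> ?S (\<lambda>t. f t - g t) + ?S (\<lambda>t. g t - h t)"
      using t by (intro add_mono SUP_upper)
    finally show "ennreal (norm (f t - h t)) \<le> ?S (\<lambda>t. f t - g t) + ?S (\<lambda>t. g t - h t)" .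
  qed
  show ?thesis
  proof
    fix \<phi> \<psi> \<eta> :: "real \<Rightarrow> 'a"
    show "0 \<le> C1_dist \<phi> \<psi>" by (simp add: C1_dist_def)
    show "C1_dist \<phi> \<psi> = C1_dist \<psi> \<phi>"
    proof -
      have "C1_norm I_inf (\<lambda>\<theta>. \<phi> \<theta> - \<psi> \<theta>) = C1_norm I_inf (\<lambda>\<theta>. \<psi> \<theta> - \<phi> \<theta>)"
        using vector_derivative_I_inf_minus[where f = "\<lambda>\<theta>. \<psi> \<theta> - \<phi> \<theta>"]
        unfolding C1_norm_def
        by (intro arg_cong2[where f = "(+)"] SUP_cong refl) (simp_all add: norm_minus_commute)
      then show ?thesis by (simp add: C1_dist_def)
    qed
    assume m: "\<phi> \<in> C1_c_within R" "\<psi> \<in> C1_c_within R"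
    show "C1_dist \<phi> \<psi> = 0 \<longleftrightarrow> \<phi> = \<psi>"
    proof
      assume "\<phi> = \<psi>" then show "C1_dist \<phi> \<psi> = 0"
        using norm_eq[OF m] by (auto simp: C1_dist_def)
    next
      assume "C1_dist \<phi> \<psi> = 0"
      then have "C1_norm I_inf (\<lambda>\<theta>. \<phi> \<theta> - \<psi> \<theta>) = 0"
        using finite_norm[OF m] by (auto simp: C1_dist_def enn2real_eq_0_iff)
      then have "?S (\<lambda>t. \<phi> t - \<psi> t) = 0"
        unfolding norm_eq[OF m] add_eq_0_iff_both_eq_0 by (rule conjunct1)
      then have "\<phi> t = \<psi> t" if "t \<in> I_inf" for t
        using SUP_upper[OF that, of "\<lambda>t. ennreal (norm (\<phi> t - \<psi> t))"] by simp
      moreover have "\<phi> t = \<psi> t" if "t \<notin> I_inf" for t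
        using that m by (auto simp: C1_c_within_def C1_c_def Map_def)
      ultimately show "\<phi> = \<psi>" by blast
    qed
    assume c: "\<eta> \<in> C1_c_within R"
    have "C1_norm I_inf (\<lambda>\<theta>. \<phi> \<theta> - \<eta> \<theta>) \<le>
        C1_norm I_inf (\<lambda>\<theta>. \<phi> \<theta> - \<psi> \<theta>) + C1_norm I_inf (\<lambda>\<theta>. \<psi> \<theta> - \<eta> \<theta>)"
      using add_mono[OF tri[of \<phi> \<eta> \<psi>] tri[of "D \<phi>" "D \<eta>" "D \<psi>"]] m c
      by (simp add: norm_eq ac_simps)
    then show "C1_dist \<phi> \<eta> \<le> C1_dist \<phi> \<psi> + C1_dist \<psi> \<eta>"
      using finite_norm[OF m(1,2)] finite_norm[OF m(2) c] unfolding C1_dist_def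
      by (subst enn2real_plus[symmetric]) (simp_all add: enn2real_mono)
  qed
qed

end

theory Submission
  imports Defs
begin

text \<open>
  Both properties say that every neighbourhood of the zero history contains a small \<open>C\<^sup>1\<close> ball of
  histories with bounded support; they only describe these histories differently.

  A prolongation \<open>\<gamma>\<close> of \<open>0\<close> over \<open>[0, T]\<close> with derivative \<open>0\<close> at \<open>0\<close> joins the zero function in a \<open>C\<^sup>1\<close>
  way, so its segment at \<open>T\<close>, which is \<open>\<gamma>\<close> translated by \<open>T\<close>, is a \<open>C\<^sup>1\<close> history supported in
  \<open>[-T, 0]\<close>.  Conversely, a \<open>C\<^sup>1\<close> history supported in \<open>[-T, 0]\<close> vanishes at \<open>-T\<close> together with its
  derivative, so translating it back gives such a prolongation.  The translation preserves the
  \<open>C\<^sup>1\<close> norm.  Hence the segments at \<open>T\<close> of the prolongations in \<^term>\<open>Gamma1 T \<delta>\<close> form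
  the closed \<open>\<delta>\<close> ball of \<^term>\<open>C1_c_within T\<close> (\<open>segments_of_Gamma1\<close>).  These balls grow with \<open>T\<close>, so the
  union over \<open>\<tau> \<in> [0, T]\<close> in the definition of \<^const>\<open>Lambda1\<close> adds nothing to the one at \<open>T\<close>
  (\<open>Lambda1_subset_iff\<close>).  Regulation therefore says that for each \<open>T\<close> every neighbourhood of \<open>0\<close> in
  \<open>H\<close> contains such a ball.

  Since the inclusion of \<^term>\<open>C1_c_within T\<close> into \<open>H\<close> is linear and addition in \<open>H\<close> is continuous,
  this is continuity of the inclusion at \<open>0\<close> and, by translation, everywhere
  (\<open>inclusion_continuous_iff_C1_ball\<close>).
\<close>

section \<open>Derivatives and the norm\<close>

lemma has_vector_derivative_translate:
  assumes "(f has_vector_derivative D) (at (a + t) within (+) a ` S)"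
  shows "((\<lambda>x. f (a + x)) has_vector_derivative D) (at t within S)"
proof -
  have "((\<lambda>x. a + x) has_vector_derivative 1) (at t within S)"
    by (auto intro!: derivative_eq_intros simp: has_vector_derivative_def)
  from vector_diff_chain_within[OF this assms] show ?thesis
    by (simp add: o_def)
qed

lemma C1_onI:
  assumes "\<And>t. t \<in> S \<Longrightarrow> (f has_vector_derivative D t) (at t within S)" and "continuous_on S D"
  shows "C1_on S f"
  using assms unfolding C1_on_def by blast

lemma at_within_atMost_nontrivial: "at t within {..s} \<noteq> bot" if "t \<le> s" for t s :: real
proof -
  have "at_left t \<noteq> bot" by simp
  moreover have "at_left t \<le> at t within {..s}" using that by (intro at_le) auto
  ultimately show ?thesis by (auto simp: bot_unique)
qed

text \<open>
  Nontriviality of the filters makes derivatives within \<open>S\<close> unique, so that any derivative at hand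
  computes the norm.
\<close>

lemma C1_norm_eq_SUP_derivative:
  assumes "\<And>t. t \<in> S \<Longrightarrow> at t within S \<noteq> bot"
    and "\<And>t. t \<in> S \<Longrightarrow> (f has_vector_derivative D t) (at t within S)"
  shows "C1_norm S f = (SUP t\<in>S. ennreal (norm (f t))) + (SUP t\<in>S. ennreal (norm (D t)))"
  unfolding C1_norm_def
  by (intro arg_cong2[where f = "(+)"] SUP_cong refl)
     (simp add: vector_derivative_within[OF assms])

lemma C1_c_within_iff:
  "\<phi> \<in> C1_c_within R \<longleftrightarrow> \<phi> \<in> Map I_inf \<and> C1_on I_inf \<phi> \<and>
    (\<forall>t. t < -R \<longrightarrow> t \<in> I_inf \<longrightarrow> \<phi> t = 0)"
proof -
  have "supp \<phi> \<subseteq> {-R..0} \<longleftrightarrow> {\<theta>\<in>I_inf. \<phi> \<theta> \<noteq> 0} \<subseteq> {-R..0}"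
    unfolding supp_def by (meson closed_atLeastAtMost closure_minimal closure_subset subset_trans)
  also have "\<dots> \<longleftrightarrow> (\<forall>t. t < -R \<longrightarrow> t \<in> I_inf \<longrightarrow> \<phi> t = 0)"
    unfolding subset_iff mem_Collect_eq atLeastAtMost_iff atMost_iff using not_le by metis
  finally have *: "supp \<phi> \<subseteq> {-R..0} \<longleftrightarrow> (\<forall>t. t < -R \<longrightarrow> t \<in> I_inf \<longrightarrow> \<phi> t = 0)" .
  have "compact (supp \<phi>)" if "supp \<phi> \<subseteq> {-R..0}"
  proof -
    have "compact ({-R..0} \<inter> supp \<phi>)"
      by (intro compact_Int_closed compact_Icc) (simp add: supp_def)
    then show ?thesis using that by (simp add: inf.absorb2)
  qed
  with * show ?thesis unfolding C1_c_within_def C1_c_def by blast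
qed

text \<open>
  At the end point \<open>-R\<close> of the support the history and its derivative are determined from the left,
  where the history is zero.
\<close>

lemma C1_c_within_derivative:
  assumes \<phi>: "\<phi> \<in> C1_c_within R" and R: "0 \<le> R"
  obtains D where "\<And>t. t \<in> I_inf \<Longrightarrow> (\<phi> has_vector_derivative D t) (at t within I_inf)"
    and "continuous_on I_inf D"
    and "\<And>t. t \<le> -R \<Longrightarrow> \<phi> t = 0" and "\<And>t. t \<le> -R \<Longrightarrow> D t = 0"
proof -
  obtain D where D: "\<And>t. t \<in> I_inf \<Longrightarrow> (\<phi> has_vector_derivative D t) (at t within I_inf)"
    and cD: "continuous_on I_inf D"
    using \<phi> unfolding C1_c_within_iff C1_on_def by blast
  have z: "\<phi> t = 0" if "t < -R" for t
    using \<phi> that R unfolding C1_c_within_iff by auto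
  have "continuous (at (-R) within {..-R}) \<phi>"
    using D[of "-R"] R has_vector_derivative_continuous continuous_within_subset[of "-R" I_inf \<phi> "{..-R}"]
    by auto
  moreover have "at_left (-R) \<le> at (-R) within {..-R}" by (intro at_le) auto
  ultimately have "(\<phi> \<longlongrightarrow> \<phi> (-R)) (at_left (-R))"
    unfolding continuous_within using tendsto_mono by blast
  moreover have "(\<phi> \<longlongrightarrow> 0) (at_left (-R))"
    by (rule tendsto_eventually) (auto simp: eventually_at_filter z)
  ultimately have "\<phi> (-R) = 0" using tendsto_unique[OF trivial_limit_at_left_real] by blast
  with z have z': "\<phi> t = 0" if "t \<le> -R" for t using that by (cases "t = -R") auto
  have Dz: "D t = 0" if t: "t \<le> -R" for t
  proof (rule vector_derivative_unique_within)
    show "at t within {..t} \<noteq> bot" by (simp add: at_within_atMost_nontrivial)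
    show "(\<phi> has_vector_derivative D t) (at t within {..t})"
      by (rule has_vector_derivative_within_subset[OF D]) (use t R in auto)
    show "(\<phi> has_vector_derivative 0) (at t within {..t})"
      by (rule has_vector_derivative_transform_within[of "\<lambda>_. 0" _ _ _ 1]) (use z' t in auto)
  qed
  show ?thesis by (rule that[of D]) (fact D cD z' Dz)+
qed

text \<open>
  Beyond the translation, the two norms differ in the range of the suprema and in the one-sided
  derivative at the left end point.  Neither matters, because the history and its derivative vanish
  on all of \<open>(-\<infinity>, -T]\<close>.
\<close>

lemma C1_norm_translate:
  assumes \<phi>: "\<phi> \<in> C1_c_within T" and T: "0 < T"
  shows "C1_norm {0..T} (\<lambda>t. \<phi> (-T + t)) = C1_norm I_inf \<phi>"
proof -
  obtain D where D: "\<And>t. t \<in> I_inf \<Longrightarrow> (\<phi> has_vector_derivative D t) (at t within I_inf)"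
    and z: "\<And>t. t \<le> -T \<Longrightarrow> \<phi> t = 0" "\<And>t. t \<le> -T \<Longrightarrow> D t = 0"
    using C1_c_within_derivative[OF \<phi> less_imp_le[OF T]] by metis
  have "((\<lambda>t. \<phi> (-T + t)) has_vector_derivative D (-T + t)) (at t within {0..T})"
    if "t \<in> {0..T}" for t
    by (rule has_vector_derivative_translate, rule has_vector_derivative_within_subset[OF D])
       (use that in auto)
  moreover have "at t within {0..T} \<noteq> bot" if "t \<in> {0..T}" for t
    using that T by (metis islimpt_Icc trivial_limit_within atLeastAtMost_iff)
  ultimately have "C1_norm {0..T} (\<lambda>t. \<phi> (-T + t)) =
      (SUP t\<in>{0..T}. ennreal (norm (\<phi> (-T + t)))) + (SUP t\<in>{0..T}. ennreal (norm (D (-T + t))))"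
    by (intro C1_norm_eq_SUP_derivative)
  also have "\<dots> = (SUP t\<in>I_inf. ennreal (norm (\<phi> t))) + (SUP t\<in>I_inf. ennreal (norm (D t)))"
  proof -
    have "(SUP t\<in>{0..T}. ennreal (norm (g (-T + t)))) = (SUP t\<in>I_inf. ennreal (norm (g t)))"
      if g: "\<And>t. t \<le> -T \<Longrightarrow> g t = 0" for g :: "real \<Rightarrow> 'a"
    proof (intro antisym SUP_least)
      fix t assume "t \<in> {0..T}"
      then show "ennreal (norm (g (-T + t))) \<le> (SUP t\<in>I_inf. ennreal (norm (g t)))"
        by (intro SUP_upper) auto
    next
      fix t assume t: "t \<in> I_inf"
      show "ennreal (norm (g t)) \<le> (SUP t\<in>{0..T}. ennreal (norm (g (-T + t))))"
      proof (cases "t \<le> -T")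
        case False
        with t SUP_upper[of "T + t" "{0..T}" "\<lambda>t. ennreal (norm (g (-T + t)))"]
        show ?thesis by auto
      qed (simp add: g)
    qed
    with z show ?thesis by presburger
  qed
  also have "\<dots> = C1_norm I_inf \<phi>"
    using D by (intro C1_norm_eq_SUP_derivative[symmetric]) (auto simp: at_within_atMost_nontrivial)
  finally show ?thesis .
qed

section \<open>Segments of prolongations of the zero history\<close>

text \<open>
  The segment consists of the translated prolongation on \<open>[-T, 0]\<close> and zero on \<open>(-\<infinity>, -T]\<close>.  The
  vanishing derivative of \<open>\<gamma>\<close> at \<open>0\<close> is what makes the two pieces join in a \<open>C\<^sup>1\<close> way.
  The second conclusion, that \<open>\<gamma>\<close> is recovered from its segment, uses the convention that \<open>\<gamma>\<close> is
  zero to the right of \<open>T\<close>.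
\<close>

lemma segment_at_prolongation:
  assumes \<gamma>: "C1_prolongation0_deriv0 {0..T} \<gamma>" and T: "0 < T"
  shows "segment_at T \<gamma> \<in> C1_c_within T" and "\<gamma> = (\<lambda>t. segment_at T \<gamma> (-T + t))"
proof -
  have m: "\<gamma> \<in> Map ({0..T} + I_inf)" and z: "\<And>t. t \<le> 0 \<Longrightarrow> \<gamma> t = 0"
    and "C1_on {0..T} \<gamma>" and d0: "(\<gamma> has_vector_derivative 0) (at 0 within {0..T})"
    using \<gamma> unfolding C1_prolongation0_deriv0_def C1_prolongation0_def atMost_iff by simp_all
  then obtain D where D: "\<And>t. t \<in> {0..T} \<Longrightarrow> (\<gamma> has_vector_derivative D t) (at t within {0..T})"
    and cD: "continuous_on {0..T} D" unfolding C1_on_def by blast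
  have D0: "D 0 = 0"
    using vector_derivative_unique_within_closed_interval[of 0 T 0 \<gamma> "D 0" 0] D[of 0] d0 T by simp
  have im: "(+) T ` {-T..0} = {0..T}" by simp
  let ?D = "\<lambda>t. if t \<in> {-T..0} then D (T + t) else 0"
  let ?g = "\<lambda>t. if t \<in> {-T..0} then \<gamma> (T + t) else 0"
  have split: "I_inf = {-T..0} \<union> {..-T}" using T by auto
  have "{-T..0} \<inter> {..-T} = {-T}" using T by auto
  then have cl: "closure {-T..0} \<inter> closure {..-T} = {-T}" by simp
  have der: "(?g has_vector_derivative ?D t) (at t within I_inf)" if t: "t \<in> I_inf" for t
  proof (rule has_vector_derivative_If_within_closures[where T = "{..-T}"], unfold cl)
    show "((\<lambda>t. \<gamma> (T + t)) has_vector_derivative D (T + t)) (at t within {-T..0} \<union> {-T})"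
      if "t \<in> {-T..0} \<union> {-T}"
    proof -
      have eq: "{-T..0} \<union> {-T} = {-T..0}" using T by auto
      have "T + t \<in> {0..T}" using that T by auto
      then show ?thesis
        unfolding eq using D[of "T + t"] by (intro has_vector_derivative_translate[unfolded im]) simp
    qed
  qed (use t split T z D0 in auto)
  have cont: "continuous_on I_inf ?D"
    unfolding split
  proof (rule continuous_on_cases)
    show "continuous_on {-T..0} (\<lambda>t. D (T + t))"
      by (intro continuous_on_compose2[OF cD] continuous_intros) auto
  qed (use D0 in auto)
  have seg: "segment_at T \<gamma> t = ?g t" if "t \<in> I_inf" for t
    using that z[of "T + t"] by (auto simp: segment_at_def)
  have "(segment_at T \<gamma> has_vector_derivative ?D t) (at t within I_inf)" if "t \<in> I_inf" for t
    by (rule has_vector_derivative_transform[OF that seg der[OF that]])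
  with cont have "C1_on I_inf (segment_at T \<gamma>)" by (intro C1_onI[where D = ?D])
  then show "segment_at T \<gamma> \<in> C1_c_within T"
    unfolding C1_c_within_iff by (simp add: seg Map_def) (simp add: segment_at_def)
  have "\<gamma> t = 0" if "t > T" for t
    using m that unfolding Map_def set_plus_def by force
  then show "\<gamma> = (\<lambda>t. segment_at T \<gamma> (-T + t))" by (auto simp: segment_at_def)
qed

lemma prolongation_of_C1_c_within:
  assumes \<phi>: "\<phi> \<in> C1_c_within T" and T: "0 < T"
  shows "C1_prolongation0_deriv0 {0..T} (\<lambda>t. \<phi> (-T + t))"
    and "segment_at T (\<lambda>t. \<phi> (-T + t)) = \<phi>"
proof -
  obtain D where D: "\<And>t. t \<in> I_inf \<Longrightarrow> (\<phi> has_vector_derivative D t) (at t within I_inf)"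
    and cD: "continuous_on I_inf D"
    and z: "\<And>t. t \<le> -T \<Longrightarrow> \<phi> t = 0" "\<And>t. t \<le> -T \<Longrightarrow> D t = 0"
    using C1_c_within_derivative[OF \<phi> less_imp_le[OF T]] by metis
  have m: "\<phi> t = 0" if "t > 0" for t
    using \<phi> that unfolding C1_c_within_iff Map_def by auto
  have der: "((\<lambda>t. \<phi> (-T + t)) has_vector_derivative D (-T + t)) (at t within {0..T})"
    if "t \<in> {0..T}" for t
    by (rule has_vector_derivative_translate, rule has_vector_derivative_within_subset[OF D])
       (use that in auto)
  have "continuous_on {0..T} (\<lambda>t. D (-T + t))"
    by (intro continuous_on_compose2[OF cD] continuous_intros) auto
  with der have "C1_on {0..T} (\<lambda>t. \<phi> (-T + t))"
    by (rule C1_onI)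
  moreover have "(\<lambda>t. \<phi> (-T + t)) \<in> Map ({0..T} + I_inf)"
  proof -
    have "t \<in> {0..T} + I_inf" if "t \<le> T" for t
      using that T set_plus_intro[of T "{0..T}" "t - T" I_inf] by simp
    then have "\<phi> (-T + t) = 0" if "t \<notin> {0..T} + I_inf" for t
      using m[of "-T + t"] that by (cases "t \<le> T") auto
    then show ?thesis by (simp add: Map_def)
  qed
  ultimately show "C1_prolongation0_deriv0 {0..T} (\<lambda>t. \<phi> (-T + t))"
    using der[of 0] z T
    unfolding C1_prolongation0_deriv0_def C1_prolongation0_def by (simp add: is_interval_cc)
  show "segment_at T (\<lambda>t. \<phi> (-T + t)) = \<phi>"
    using m by (auto simp: segment_at_def)
qed

lemma segments_of_Gamma1:
  assumes T: "0 < T"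
  shows "segment_at T ` Gamma1 T \<delta> = {\<phi> \<in> C1_c_within T. C1_norm I_inf \<phi> \<le> \<delta>}"
proof (intro equalityI subsetI)
  fix \<phi> :: "real \<Rightarrow> 'a" assume "\<phi> \<in> segment_at T ` Gamma1 T \<delta>"
  then obtain \<gamma> where \<gamma>: "C1_prolongation0_deriv0 {0..T} \<gamma>" "C1_norm {0..T} \<gamma> \<le> \<delta>"
    and \<phi>: "\<phi> = segment_at T \<gamma>"
    using T by (auto simp: Gamma1_def)
  note seg = segment_at_prolongation[OF \<gamma>(1) T, folded \<phi>]
  show "\<phi> \<in> {\<phi> \<in> C1_c_within T. C1_norm I_inf \<phi> \<le> \<delta>}"
    using seg(1) \<gamma>(2) C1_norm_translate[OF seg(1) T] seg(2) by simp
next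
  fix \<phi> :: "real \<Rightarrow> 'a" assume "\<phi> \<in> {\<phi> \<in> C1_c_within T. C1_norm I_inf \<phi> \<le> \<delta>}"
  then have \<phi>: "\<phi> \<in> C1_c_within T" "C1_norm I_inf \<phi> \<le> \<delta>" by auto
  have "(\<lambda>t. \<phi> (-T + t)) \<in> Gamma1 T \<delta>"
    using prolongation_of_C1_c_within(1)[OF \<phi>(1) T] C1_norm_translate[OF \<phi>(1) T] \<phi>(2) T
    by (simp add: Gamma1_def)
  then show "\<phi> \<in> segment_at T ` Gamma1 T \<delta>"
    using prolongation_of_C1_c_within(2)[OF \<phi>(1) T] by (metis image_eqI)
qed

section \<open>The normed spaces of histories with bounded support\<close>

lemma C1_c_within_mono: "R \<le> S \<Longrightarrow> C1_c_within R \<subseteq> C1_c_within S"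
  unfolding C1_c_within_def by fastforce

lemma zero_in_C1_c_within: "(\<lambda>_. 0) \<in> C1_c_within R"
  unfolding C1_c_within_iff C1_on_def Map_def
  by (auto intro!: exI[of _ "\<lambda>_. 0"])

lemma diff_in_C1_c_within:
  assumes "\<phi> \<in> C1_c_within R" "\<psi> \<in> C1_c_within R"
  shows "(\<lambda>\<theta>. \<phi> \<theta> - \<psi> \<theta>) \<in> C1_c_within R"
proof -
  obtain D D' where "\<forall>t\<in>I_inf. (\<phi> has_vector_derivative D t) (at t within I_inf)"
    and "\<forall>t\<in>I_inf. (\<psi> has_vector_derivative D' t) (at t within I_inf)"
    and "continuous_on I_inf D" "continuous_on I_inf D'"
    using assms unfolding C1_c_within_iff C1_on_def by blast
  then have "continuous_on I_inf (\<lambda>t. D t - D' t)"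
      "\<forall>t\<in>I_inf. ((\<lambda>\<theta>. \<phi> \<theta> - \<psi> \<theta>) has_vector_derivative D t - D' t) (at t within I_inf)"
    by (simp_all add: continuous_on_diff has_vector_derivative_diff)
  then have "C1_on I_inf (\<lambda>\<theta>. \<phi> \<theta> - \<psi> \<theta>)"
    by (intro C1_onI[where D = "\<lambda>t. D t - D' t"]) simp_all
  then show ?thesis using assms unfolding C1_c_within_iff Map_def by auto
qed

lemma scaleR_in_C1_c_within:
  assumes "\<phi> \<in> C1_c_within R"
  shows "(\<lambda>\<theta>. c *\<^sub>R \<phi> \<theta>) \<in> C1_c_within R"
proof -
  obtain D where D: "\<forall>t\<in>I_inf. (\<phi> has_vector_derivative D t) (at t within I_inf)"
    and "continuous_on I_inf D"
    using assms unfolding C1_c_within_iff C1_on_def by blast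
  then have "continuous_on I_inf (\<lambda>t. c *\<^sub>R D t)"
      "\<forall>t\<in>I_inf. ((\<lambda>\<theta>. c *\<^sub>R \<phi> \<theta>) has_vector_derivative c *\<^sub>R D t) (at t within I_inf)"
    by (auto intro: continuous_on_scaleR bounded_linear.has_vector_derivative[OF bounded_linear_scaleR_right])
  then have "C1_on I_inf (\<lambda>\<theta>. c *\<^sub>R \<phi> \<theta>)"
    by (intro C1_onI[where D = "\<lambda>t. c *\<^sub>R D t"]) simp_all
  then show ?thesis using assms unfolding C1_c_within_iff Map_def by auto
qed

lemma C1_norm_finite:
  assumes "\<phi> \<in> C1_c_within R"
  shows "C1_norm I_inf \<phi> < \<infinity>"
proof -
  obtain D where D: "\<And>t. t \<in> I_inf \<Longrightarrow> (\<phi> has_vector_derivative D t) (at t within I_inf)"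
    and b: "bounded (\<phi> ` I_inf)" "bounded (D ` I_inf)"
    using C1_c_within_bounded[OF assms] by metis
  have "(SUP t\<in>I_inf. ennreal (norm (g t))) < \<infinity>" if b: "bounded (g ` I_inf)" for g :: "real \<Rightarrow> 'a"
  proof -
    obtain B where "\<forall>x\<in>g ` I_inf. norm x \<le> B" using b by (auto simp: bounded_iff)
    then have "(SUP t\<in>I_inf. ennreal (norm (g t))) \<le> ennreal B"
      by (intro SUP_least ennreal_leI) auto
    also have "\<dots> < \<infinity>" by simp
    finally show ?thesis .
  qed
  from this[OF b(1)] this[OF b(2)] show ?thesis
    by (subst C1_norm_eq_SUP_derivative[OF _ D]) (simp_all add: at_within_atMost_nontrivial)
qed

lemma C1_norm_scaleR:
  assumes \<phi>: "\<phi> \<in> C1_c_within R"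
  shows "C1_norm I_inf (\<lambda>\<theta>. c *\<^sub>R \<phi> \<theta>) = ennreal \<bar>c\<bar> * C1_norm I_inf \<phi>"
proof -
  obtain D where D: "\<And>t. t \<in> I_inf \<Longrightarrow> (\<phi> has_vector_derivative D t) (at t within I_inf)"
    using C1_c_within_bounded[OF \<phi>] by metis
  have cD: "((\<lambda>\<theta>. c *\<^sub>R \<phi> \<theta>) has_vector_derivative c *\<^sub>R D t) (at t within I_inf)"
    if "t \<in> I_inf" for t
    by (rule bounded_linear.has_vector_derivative[OF bounded_linear_scaleR_right D[OF that]])
  have "(SUP t\<in>I_inf. ennreal (norm (c *\<^sub>R g t))) = ennreal \<bar>c\<bar> * (SUP t\<in>I_inf. ennreal (norm (g t)))"
    for g :: "real \<Rightarrow> 'a"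
    by (simp add: ennreal_mult SUP_mult_left_ennreal)
  then show ?thesis
    using C1_norm_eq_SUP_derivative[of I_inf \<phi> D] C1_norm_eq_SUP_derivative[OF _ cD] D
    by (simp add: at_within_atMost_nontrivial distrib_left)
qed

lemma ennreal_positive_real_below:
  assumes "0 < (\<delta> :: ennreal)"
  obtains d where "0 < d" and "ennreal d \<le> \<delta>"
proof (cases \<delta>)
  case (real r)
  with assms that[of r] show ?thesis by simp
next
  case top
  with that[of 1] show ?thesis by simp
qed

text \<open>
  This serves to put histories of arbitrary norm into \<open>H\<close>: a multiple in a small ball lies in \<open>H\<close>, and
  \<open>H\<close> is a linear space.
\<close>

lemma small_multiple_in_C1_ball:
  assumes \<phi>: "\<phi> \<in> C1_c_within R" and \<delta>: "0 < (\<delta> :: ennreal)"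
  obtains c where "0 < c" and "C1_norm I_inf (\<lambda>\<theta>. c *\<^sub>R \<phi> \<theta>) \<le> \<delta>"
proof -
  obtain b where b: "C1_norm I_inf \<phi> = ennreal b" "0 \<le> b"
    using C1_norm_finite[OF \<phi>] by (cases "C1_norm I_inf \<phi>") auto
  obtain d where d: "0 < d" "ennreal d \<le> \<delta>"
    using ennreal_positive_real_below[OF \<delta>] .
  \<comment> \<open>Dividing by \<open>b + 1\<close> instead of the norm \<open>b\<close> covers the zero history as well.\<close>
  have "d / (b + 1) * b \<le> d" using b d by (simp add: field_simps)
  then have "ennreal (d / (b + 1)) * ennreal b \<le> ennreal d"
    using b d by (simp flip: ennreal_mult add: ennreal_leI)
  then have "C1_norm I_inf (\<lambda>\<theta>. (d / (b + 1)) *\<^sub>R \<phi> \<theta>) \<le> \<delta>"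
    unfolding C1_norm_scaleR[OF \<phi>] b(1) using b d by (auto intro: order_trans)
  moreover have "0 < d / (b + 1)" using b d by simp
  ultimately show ?thesis using that by blast
qed

section \<open>Linear topologies on history spaces\<close>

lemma openin_translate:
  assumes H: "history_space H" and U: "openin H U" and \<phi>: "\<phi> \<in> topspace H"
  shows "openin H {\<psi> \<in> topspace H. (\<lambda>\<theta>. \<phi> \<theta> + \<psi> \<theta>) \<in> U}"
proof -
  have "continuous_map H (prod_topology H H) (\<lambda>\<psi>. (\<phi>, \<psi>))"
    using \<phi> by (simp add: continuous_map_pairedI)
  moreover have "continuous_map (prod_topology H H) H (\<lambda>(\<phi>, \<psi>). \<lambda>\<theta>. \<phi> \<theta> + \<psi> \<theta>)"
    using H by (simp add: history_space_def)
  ultimately have "continuous_map H H ((\<lambda>(\<phi>, \<psi>). \<lambda>\<theta>. \<phi> \<theta> + \<psi> \<theta>) \<circ> (\<lambda>\<psi>. (\<phi>, \<psi>)))"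
    by (rule continuous_map_compose)
  then have "continuous_map H H (\<lambda>\<psi>. \<lambda>\<theta>. \<phi> \<theta> + \<psi> \<theta>)" by (simp add: o_def)
  from openin_continuous_map_preimage[OF this U] show ?thesis .
qed

text \<open>
  The ball condition is continuity of the inclusion at \<open>0\<close>.  It also yields that the inclusion maps
  into \<open>H\<close>, by taking all of \<open>H\<close> as the neighbourhood and scaling.  Continuity at another point
  \<open>\<phi>\<close> follows because \<open>U - \<phi>\<close> is a neighbourhood of \<open>0\<close> for every open \<open>U\<close> containing \<open>\<phi>\<close>.
\<close>

lemma inclusion_continuous_iff_C1_ball:
  assumes H: "history_space H"
  shows "continuous_map (uniform_C1_topology R) H (\<lambda>\<phi>. \<phi>) \<longleftrightarrow>
    (\<forall>N. nbhd_in H (\<lambda>_. 0) N \<longrightarrow> (\<exists>\<delta>>0. {\<phi> \<in> C1_c_within R. C1_norm I_inf \<phi> \<le> \<delta>} \<subseteq> N))"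
    (is "?cont \<longleftrightarrow> ?ball")
proof -
  interpret M: Metric_space "C1_c_within R :: (real \<Rightarrow> 'a) set" C1_dist
    by (rule Metric_space_C1_dist)
  have top: "uniform_C1_topology R = M.mtopology" by (simp add: uniform_C1_topology_def)
  show ?thesis
  proof
    assume cont: ?cont
    show ?ball
    proof (intro allI impI)
      fix N assume "nbhd_in H (\<lambda>_. 0) N"
      then obtain U where U: "openin H U" "(\<lambda>_. 0) \<in> U" "U \<subseteq> N" by (auto simp: nbhd_in_def)
      have "openin M.mtopology {\<phi> \<in> C1_c_within R. \<phi> \<in> U}"
        using openin_continuous_map_preimage[OF cont U(1)] by (simp add: top)
      moreover have "(\<lambda>_. 0) \<in> {\<phi> \<in> C1_c_within R. \<phi> \<in> U}"
        using U(2) zero_in_C1_c_within[of R] by simp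
      ultimately have "\<exists>r>0. M.mball (\<lambda>_. 0) r \<subseteq> {\<phi> \<in> C1_c_within R. \<phi> \<in> U}"
        unfolding M.openin_mtopology by (elim conjE allE impE)
      then obtain r where r: "r > 0" "M.mball (\<lambda>_. 0) r \<subseteq> {\<phi> \<in> C1_c_within R. \<phi> \<in> U}"
        by (elim exE conjE)
      \<comment> \<open>Metric balls are open and norm balls closed, hence the radius \<open>r / 2\<close>.\<close>
      have "\<phi> \<in> N" if \<phi>: "\<phi> \<in> C1_c_within R" "C1_norm I_inf \<phi> \<le> ennreal (r / 2)" for \<phi>
      proof -
        have "C1_dist \<phi> (\<lambda>_. 0) \<le> r / 2"
          using enn2real_mono[OF \<phi>(2)] r(1) by (simp add: C1_dist_def)
        then have "\<phi> \<in> M.mball (\<lambda>_. 0) r"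
          using r(1) \<phi>(1) zero_in_C1_c_within[of R] M.commute[of \<phi> "\<lambda>_. 0"] by simp
        with r(2) U(3) show ?thesis by blast
      qed
      with r(1) show "\<exists>\<delta>>0. {\<phi> \<in> C1_c_within R. C1_norm I_inf \<phi> \<le> \<delta>} \<subseteq> N"
        by (intro exI[of _ "ennreal (r / 2)"]) auto
    qed
  next
    assume ball: ?ball
    have sub: "\<phi> \<in> topspace H" if \<phi>: "\<phi> \<in> C1_c_within R" for \<phi>
    proof -
      have "nbhd_in H (\<lambda>_. 0) (topspace H)"
        using H by (auto simp: nbhd_in_def history_space_def)
      with ball obtain \<delta> where \<delta>: "\<delta> > 0"
        "{\<phi> \<in> C1_c_within R. C1_norm I_inf \<phi> \<le> \<delta>} \<subseteq> topspace H" by blast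
      obtain c where c: "0 < c" "C1_norm I_inf (\<lambda>\<theta>. c *\<^sub>R \<phi> \<theta>) \<le> \<delta>"
        using small_multiple_in_C1_ball[OF \<phi> \<delta>(1)] .
      then have "(\<lambda>\<theta>. c *\<^sub>R \<phi> \<theta>) \<in> topspace H"
        using \<delta>(2) scaleR_in_C1_c_within[OF \<phi>] by blast
      then have "(\<lambda>\<theta>. inverse c *\<^sub>R c *\<^sub>R \<phi> \<theta>) \<in> topspace H"
        using H[unfolded history_space_def] by (elim conjE) (drule spec, drule bspec)
      with c(1) show ?thesis by simp
    qed
    have "openin M.mtopology {\<phi> \<in> C1_c_within R. \<phi> \<in> U}" if U: "openin H U" for U
      unfolding M.openin_mtopology
    proof (intro conjI allI impI)
      fix \<phi> assume "\<phi> \<in> {\<phi> \<in> C1_c_within R. \<phi> \<in> U}"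
      then have \<phi>: "\<phi> \<in> C1_c_within R" "\<phi> \<in> U" by auto
      let ?V = "{\<psi> \<in> topspace H. (\<lambda>\<theta>. \<phi> \<theta> + \<psi> \<theta>) \<in> U}"
      have "nbhd_in H (\<lambda>_. 0) ?V"
        using openin_translate[OF H U sub[OF \<phi>(1)]] \<phi>(2) H
        by (auto simp: nbhd_in_def history_space_def)
      with ball obtain \<delta> where \<delta>: "\<delta> > 0"
        "{\<phi> \<in> C1_c_within R. C1_norm I_inf \<phi> \<le> \<delta>} \<subseteq> ?V" by blast
      obtain d where d: "0 < d" "ennreal d \<le> \<delta>"
        using ennreal_positive_real_below[OF \<delta>(1)] .
      have "\<psi> \<in> U" if \<psi>: "\<psi> \<in> C1_c_within R" "C1_dist \<phi> \<psi> < d" for \<psi>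
      proof -
        let ?\<eta> = "\<lambda>\<theta>. \<psi> \<theta> - \<phi> \<theta>"
        have \<eta>: "?\<eta> \<in> C1_c_within R" using diff_in_C1_c_within \<psi>(1) \<phi>(1) by blast
        have "enn2real (C1_norm I_inf ?\<eta>) < d"
          using \<psi>(2) M.commute[of \<phi> \<psi>] by (simp add: C1_dist_def)
        then have "C1_norm I_inf ?\<eta> \<le> ennreal d"
          using C1_norm_finite[OF \<eta>] by (cases "C1_norm I_inf ?\<eta>") (auto intro: ennreal_leI)
        with d(2) \<delta>(2) \<eta> have "?\<eta> \<in> ?V" by (auto intro: order_trans)
        then show ?thesis by simp
      qed
      then have "M.mball \<phi> d \<subseteq> {\<phi> \<in> C1_c_within R. \<phi> \<in> U}" by auto
      with d(1) show "\<exists>r>0. M.mball \<phi> r \<subseteq> {\<phi> \<in> C1_c_within R. \<phi> \<in> U}" by blast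
    qed auto
    with sub show ?cont
      by (auto simp: top continuous_map_def)
  qed
qed

lemma Lambda1_subset_iff:
  assumes T: "0 < T" and N: "(\<lambda>_. 0) \<in> N"
  shows "Lambda1 T \<delta> \<subseteq> {0..T} \<times> N \<longleftrightarrow> {\<phi> \<in> C1_c_within T. C1_norm I_inf \<phi> \<le> \<delta>} \<subseteq> N"
proof -
  have "Lambda1 T \<delta> \<subseteq> {0..T} \<times> N \<longleftrightarrow> (\<forall>\<tau>\<in>{0..T}. segment_at \<tau> ` Gamma1 \<tau> \<delta> \<subseteq> N)"
    unfolding Lambda1_def by blast
  also have "\<dots> \<longleftrightarrow> (\<forall>\<tau>\<in>{0<..T}. segment_at \<tau> ` Gamma1 \<tau> \<delta> \<subseteq> N)"
  proof -
    have "segment_at 0 ` Gamma1 0 \<delta> \<subseteq> N" using N by (simp add: Gamma1_def segment_at_def)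
    then show ?thesis
      by (metis atLeastAtMost_iff greaterThanAtMost_iff order_le_less)
  qed
  also have "\<dots> \<longleftrightarrow> (\<forall>\<tau>\<in>{0<..T}. {\<phi> \<in> C1_c_within \<tau>. C1_norm I_inf \<phi> \<le> \<delta>} \<subseteq> N)"
    by (simp add: segments_of_Gamma1)
  also have "\<dots> \<longleftrightarrow> {\<phi> \<in> C1_c_within T. C1_norm I_inf \<phi> \<le> \<delta>} \<subseteq> N"
    using T C1_c_within_mono[of _ T] by fastforce
  finally show ?thesis .
qed

theorem theorem3p14:
  fixes H :: "(real \<Rightarrow> 'e::banach) topology"
  assumes "history_space H"
    and "zero_closed_under_C1_prolongations H"
  shows "regulated_by_C1_prolongations H \<longleftrightarrow>
    (\<forall>R>0. continuous_map (uniform_C1_topology R) H (\<lambda>\<phi>. \<phi>))"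
proof -
  have "(\<lambda>_. 0) \<in> N" if "nbhd_in H (\<lambda>_. 0) N" for N
    using that by (auto simp: nbhd_in_def)
  then show ?thesis
    unfolding regulated_by_C1_prolongations_def inclusion_continuous_iff_C1_ball[OF assms(1)]
    by (simp add: Lambda1_subset_iff)
qed

end
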